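(* Let $\mathbb{A}$ be a nonnegative tensor with order $m\ge 2$ and dimension $n$. If $M(\mathbb{A})$ is primitive, then $\mathbb{A}$ is also primitive and in this case $$\gamma(\mathbb{A})\le\gamma(M(\mathbb{A}))\le(n-1)^2+1.$$
   Context: An order $m$ dimension $n$ tensor is an array $\mathbb{A}=(a_{i_1\cdots i_m})$ indexed by $[n]^m$, $[n]=\{1,\dots,n\}$; it is nonnegative if all entries are real and $\ge 0$. The majorization matrix $M(\mathbb{A})$ is the $n\times n$ matrix with $(M(\mathbb{A}))_{ij}=a_{ij\cdots j}$. For $x\in\mathbb{R}^n$, $(\mathbb{A}x)_i=\sum_{i_2,\dots,i_m=1}^n a_{ii_2\cdots i_m}x_{i_2}\cdots x_{i_m}$. For nonnegative $\mathbb{A}$, let $T_{\mathbb{A}}(x)=(\mathbb{A}x)^{[\frac{1}{m-1}]}$ (componentwise $(m-1)$-th root) for nonnegative $x\in\mathbb{R}^n$. $\mathbb{A}$ is primitive if there is a positive integer $r$ such that $T_{\mathbb{A}}^r(x)>0$ (all components positive; $T_{\mathbb{A}}^r$ the $r$-fold iterate) for all nonnegative nonzero $x\in\mathbb{R}^n$; the smallest such $r$ is the primitive degree $\gamma(\mathbb{A})$. For a nonnegative matrix $M$ (the case $m=2$), primitivity means that some power $M^r$ ($r\ge1$) is entrywise positive, and $\gamma(M)$ is the smallest such $r$. *)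

theory Defs
  imports "HOL-Analysis.Analysis"
begin

text \<open>
  The index set \<open>[n]\<close> is rendered by a finite type \<open>'n\<close>, so that the dimension is \<open>CARD('n)\<close>.
  A tensor of order \<open>m\<close> is a function on multi-indices given as lists over \<open>'n\<close>; only its values
  on lists of length \<open>m\<close> are its entries, and for \<open>m \<ge> 1\<close> no definition below looks at any other value.
  The notions of primitivity are those for nonnegative tensors and matrices; nonnegativity is
  not part of the definitions.
\<close>

type_synonym 'n tensor = "'n list \<Rightarrow> real"

definition nonneg_tensor :: "nat \<Rightarrow> 'n::finite tensor \<Rightarrow> bool" where
  "nonneg_tensor m A \<longleftrightarrow> (\<forall>is. length is = m \<longrightarrow> 0 \<le> A is)"

definition tensor_apply :: "nat \<Rightarrow> 'n::finite tensor \<Rightarrow> real ^ 'n \<Rightarrow> real ^ 'n" where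
  "tensor_apply m A x =
     (\<chi> i. \<Sum>js | length js = m - 1. A (i # js) * (\<Prod>j\<leftarrow>js. x $ j))"

definition tensor_map :: "nat \<Rightarrow> 'n::finite tensor \<Rightarrow> real ^ 'n \<Rightarrow> real ^ 'n" where
  "tensor_map m A x = (\<chi> i. root (m - 1) (tensor_apply m A x $ i))"

definition tensor_map_pos :: "nat \<Rightarrow> 'n::finite tensor \<Rightarrow> nat \<Rightarrow> bool" where
  "tensor_map_pos m A r \<longleftrightarrow>
     (\<forall>x. (\<forall>i. 0 \<le> x $ i) \<and> x \<noteq> 0 \<longrightarrow> (\<forall>i. 0 < (tensor_map m A ^^ r) x $ i))"

definition tensor_primitive :: "nat \<Rightarrow> 'n::finite tensor \<Rightarrow> bool" where
  "tensor_primitive m A \<longleftrightarrow> (\<exists>r\<ge>1. tensor_map_pos m A r)"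

definition tensor_primitive_degree :: "nat \<Rightarrow> 'n::finite tensor \<Rightarrow> nat" where
  "tensor_primitive_degree m A = (LEAST r. r \<ge> 1 \<and> tensor_map_pos m A r)"

definition majorization_matrix :: "nat \<Rightarrow> 'n::finite tensor \<Rightarrow> real ^ 'n ^ 'n" where
  "majorization_matrix m A = (\<chi> i j. A (i # replicate (m - 1) j))"

text \<open>
  On \<open>real ^ 'n ^ 'n\<close> the operation \<open>^\<close> acts entrywise, hence the iterated matrix product.
\<close>

definition matrix_power :: "real ^ 'n ^ 'n \<Rightarrow> nat \<Rightarrow> real ^ 'n::finite ^ 'n" where
  "matrix_power M r = (((**) M) ^^ r) (mat 1)"

definition matrix_power_pos :: "real ^ 'n ^ 'n::finite \<Rightarrow> nat \<Rightarrow> bool" where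
  "matrix_power_pos M r \<longleftrightarrow> (\<forall>i j. 0 < matrix_power M r $ i $ j)"

definition matrix_primitive :: "real ^ 'n ^ 'n::finite \<Rightarrow> bool" where
  "matrix_primitive M \<longleftrightarrow> (\<exists>r\<ge>1. matrix_power_pos M r)"

definition matrix_primitive_degree :: "real ^ 'n ^ 'n::finite \<Rightarrow> nat" where
  "matrix_primitive_degree M = (LEAST r. r \<ge> 1 \<and> matrix_power_pos M r)"

end

theory Submission
  imports Defs
begin

text \<open>
  Positivity of the entries of a power of a nonnegative matrix \<open>M\<close> only depends on the walks of
  the digraph \<open>E = {(i, j). M $ i $ j > 0}\<close>. An edge \<open>(i, j)\<close> of the digraph of \<open>M(A)\<close> comes with
  a term \<open>a x\<^sub>j ^ (m - 1)\<close> of \<open>(A x)\<^sub>i\<close> with \<open>a > 0\<close>, so positivity of components of \<open>x\<close> propagates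
  along walks, which gives the first inequality.

  The second inequality is Wielandt's bound. Let \<open>n\<close> be the number of vertices and
  \<open>s\<close> the length of a shortest closed walk. When
  \<open>n \<ge> 2\<close>, some vertex \<open>u\<close> has two successors, and since at least \<open>n - 1\<close> vertices have distance at
  most \<open>n - 2\<close> to \<open>u\<close>, one of the successors does, whence \<open>s \<le> n - 1\<close>. The set \<open>C\<close> of vertices
  that lie on a closed walk of length \<open>s\<close> has at least \<open>s\<close> elements and is reached from everywhere
  in exactly \<open>n - s\<close> steps. The vertices of \<open>C\<close> have loops in \<open>E ^^ s\<close>, so from each of them
  everything is reached in exactly \<open>n - 1\<close> steps of \<open>E ^^ s\<close>. The walks so obtained have length
  \<open>(n - s) + s (n - 1) \<le> (n - 1)\<^sup>2 + 1\<close>.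
\<close>

section \<open>Wielandt's bound for relations\<close>

lemma Image_relpow_Suc: "(R ^^ Suc k) `` X = R `` ((R ^^ k) `` X)"
  by (simp add: relcomp_Image)

lemma relpow_converse: "(R\<inverse>) ^^ k = (R ^^ k)\<inverse>" for R :: "'a rel"
proof (induction k)
  case (Suc k)
  have "(R\<inverse>) ^^ Suc k = (R ^^ k)\<inverse> O R\<inverse>" using Suc by simp
  also have "\<dots> = (R O R ^^ k)\<inverse>" by (simp add: converse_relcomp)
  finally show ?case by (simp add: relpow_commute)
qed auto

lemma relpow_mult: "R ^^ (k * l) = (R ^^ k) ^^ l" for R :: "'a rel"
  by (induction l) (simp_all add: relpow_add relpow_commute)

lemma relpow_subset: "R \<subseteq> S \<Longrightarrow> R ^^ k \<subseteq> S ^^ k" for R :: "'a rel"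
  by (induction k) (auto intro: relcomp_mono)

text \<open>Idle steps can be deleted from a walk. Powers of \<open>R \<union> Id\<close> thus
  encode distance at most \<open>k\<close>.\<close>

lemma relpow_Un_Id_D:
  assumes "(a, b) \<in> (R \<union> Id) ^^ k"
  obtains l where "l \<le> k" "(a, b) \<in> R ^^ l"
proof -
  have "\<exists>l\<le>k. (a, b) \<in> R ^^ l" using assms
  proof (induction k arbitrary: b)
    case (Suc k)
    then obtain c where "(a, c) \<in> (R \<union> Id) ^^ k" and cb: "(c, b) \<in> R \<union> Id" by auto
    with Suc.IH obtain l where l: "l \<le> k" "(a, c) \<in> R ^^ l" by blast
    show ?case
    proof (cases "c = b")
      case True
      then show ?thesis using l le_SucI by blast
    next
      case False
      then have "(a, b) \<in> R ^^ Suc l" using l cb by auto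
      then show ?thesis using l(1) Suc_le_mono by blast
    qed
  qed auto
  then show ?thesis using that by blast
qed

lemma relpow_segment:
  assumes "\<forall>i<s. (f i, f (Suc i)) \<in> R" "a + d \<le> s"
  shows "(f a, f (a + d)) \<in> R ^^ d"
  unfolding relpow_fun_conv using assms by (intro exI[of _ "\<lambda>i. f (a + i)"]) auto

text \<open>The images form an increasing chain. If two consecutive ones agree, the chain is
  constant from there on and \<open>all\<close> forces it to be everything; otherwise the step gains
  a vertex.\<close>

lemma card_Image_relpow_ge:
  fixes R :: "'a::finite rel"
  assumes sub: "X \<subseteq> R `` X" and all: "(R ^^ N) `` X = UNIV"
  shows "min CARD('a) (card X + k) \<le> card ((R ^^ k) `` X)"
proof (induction k)
  case (Suc k)
  let ?Y = "\<lambda>k. (R ^^ k) `` X"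
  have mono: "?Y k \<subseteq> ?Y (Suc k)" for k
  proof (induction k)
    case (Suc k)
    then show ?case unfolding Image_relpow_Suc[of _ R] by blast
  qed (use sub in simp)
  show ?case
  proof (cases "?Y (Suc k) = ?Y k")
    case True
    have "?Y (k + l) = ?Y k" for l
    proof (induction l)
      case (Suc l)
      then show ?case using True by (metis Image_relpow_Suc add_Suc_right)
    qed simp
    moreover have "?Y N \<subseteq> ?Y (k + N)" 
      by (rule lift_Suc_mono_le[of ?Y, OF mono]) simp
    ultimately have "?Y k = UNIV" using all by blast
    then have "?Y (Suc k) = UNIV" using True by simp
    then show ?thesis by simp
  next
    case False
    then have "?Y k \<subset> ?Y (Suc k)" using mono by blast
    then have "card (?Y k) < card (?Y (Suc k))" by (intro psubset_card_mono) auto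
    then show ?thesis using Suc by linarith
  qed
qed simp

lemma Image_relpow_eq_UNIV:
  fixes R :: "'a::finite rel"
  assumes "X \<subseteq> R `` X" "(R ^^ N) `` X = UNIV" "CARD('a) \<le> card X + k"
  shows "(R ^^ k) `` X = UNIV"
proof -
  have "CARD('a) \<le> card ((R ^^ k) `` X)"
    using card_Image_relpow_ge[OF assms(1,2), of k] assms(3) by simp
  then show ?thesis by (intro card_seteq) auto
qed

lemma relpow_UNIV_mono:
  fixes R :: "'a rel"
  assumes "R ^^ k = UNIV" "Domain R = UNIV" "k \<le> l"
  shows "R ^^ l = UNIV"
  using assms(3)
proof (induction rule: dec_induct)
  case (step l)
  have "(a, b) \<in> R ^^ Suc l" for a b
  proof -
    obtain c where "(a, c) \<in> R" using assms(2) by blast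
    then show ?thesis using step.IH by (intro relpow_Suc_I2[of a c]) auto
  qed
  then show ?case by auto
qed (rule assms(1))

text \<open>Without branching, each vertex would start at most one walk of length \<open>N\<close>,
  hence reach at most one vertex.\<close>

lemma exists_branching:
  fixes R :: "'a::finite rel"
  assumes "R ^^ N = UNIV" "2 \<le> CARD('a)"
  obtains u v w where "(u, v) \<in> R" "(u, w) \<in> R" "v \<noteq> w"
proof (rule ccontr)
  assume "\<not> thesis"
  then have sv: "single_valued R" using that by (auto simp: single_valued_def)
  have "single_valued (R ^^ N)" using sv by (rule single_valued_relpow)
  then have "a = b" for a b :: 'a using assms(1) by (metis UNIV_I single_valuedD)
  then have "CARD('a) \<le> Suc 0" by (subst card_le_Suc0_iff_eq) auto
  then show False using assms(2) by simp
qed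

lemma short_closed_walk:
  fixes R :: "'a::finite rel"
  assumes N: "R ^^ N = UNIV" and card: "2 \<le> CARD('a)"
  obtains u s where "1 \<le> s" "s \<le> CARD('a) - 1" "(u, u) \<in> R ^^ s"
proof -
  obtain u v w where uvw: "(u, v) \<in> R" "(u, w) \<in> R" "v \<noteq> w"
    using exists_branching[OF N card] .
  \<comment> \<open>The converse makes \<open>?Y\<close> the set of vertices at distance at most
    \<open>CARD('a) - 2\<close> to \<open>u\<close>; the added loops make the images of
    \<open>{u}\<close> increase.\<close>
  let ?S = "(R \<union> Id)\<inverse>"
  let ?Y = "(?S ^^ (CARD('a) - 2)) `` {u}"
  have "(R \<union> Id) ^^ N = UNIV" using relpow_subset[of R "R \<union> Id" N] N by auto
  then have "(?S ^^ N) `` {u} = UNIV" by (auto simp: relpow_converse)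
  then have "min CARD('a) (card {u} + (CARD('a) - 2)) \<le> card ?Y"
    by (intro card_Image_relpow_ge) auto
  then have Y: "CARD('a) - 1 \<le> card ?Y" using card by simp
  have "v \<in> ?Y \<or> w \<in> ?Y"
  proof (rule ccontr)
    assume "\<not> ?thesis"
    then have "card ?Y \<le> card (UNIV - {v, w})" by (intro card_mono) auto
    also have "\<dots> = CARD('a) - 2" using uvw(3) by (subst card_Diff_subset) auto
    finally show False using Y card by simp
  qed
  then obtain y where "(u, y) \<in> R" "y \<in> ?Y" using uvw by blast
  then have "(y, u) \<in> (R \<union> Id) ^^ (CARD('a) - 2)" by (auto simp: relpow_converse)
  then obtain l where l: "l \<le> CARD('a) - 2" "(y, u) \<in> R ^^ l" by (rule relpow_Un_Id_D)
  show thesis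
  proof (rule that)
    show "(u, u) \<in> R ^^ Suc l" using \<open>(u, y) \<in> R\<close> l(2) by (rule relpow_Suc_I2)
  qed (use l(1) card in auto)
qed

text \<open>The first \<open>s\<close> vertices of the walk are distinct, since a repetition would
  cut out a shorter closed walk, and rotating the walk closes it at each of them.\<close>

lemma card_closed_walk_ge:
  fixes R :: "'a::finite rel"
  assumes u: "(u, u) \<in> R ^^ s"
    and least: "\<And>l c. 1 \<le> l \<Longrightarrow> l < s \<Longrightarrow> (c, c) \<notin> R ^^ l"
  shows "s \<le> card {c. (c, c) \<in> R ^^ s}"
proof -
  obtain f where f: "f 0 = u" "f s = u" "\<forall>i<s. (f i, f (Suc i)) \<in> R"
    using u unfolding relpow_fun_conv by blast
  have "(f i, f i) \<in> R ^^ s" if "i < s" for i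
  proof -
    have "(f i, f s) \<in> R ^^ (s - i)" "(f 0, f i) \<in> R ^^ i"
      using relpow_segment[OF f(3), of i "s - i"] relpow_segment[OF f(3), of 0 i] that by auto
    then have "(f i, f i) \<in> R ^^ (s - i + i)" unfolding relpow_add f(1,2) by blast
    then show ?thesis using that by simp
  qed
  then have "f ` {..<s} \<subseteq> {c. (c, c) \<in> R ^^ s}" by auto
  moreover have "inj_on f {..<s}"
  proof (rule linorder_inj_onI)
    fix a b assume ab: "a < b" "b \<in> {..<s}"
    then have "(f a, f b) \<in> R ^^ (b - a)" using relpow_segment[OF f(3), of a "b - a"] by simp
    moreover have "1 \<le> b - a" "b - a < s" using ab by auto
    ultimately show "f a \<noteq> f b" using least[of "b - a" "f a"] by auto
  qed auto
  ultimately show ?thesis by (metis card_inj_on_le card_lessThan finite)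
qed

text \<open>Rotating a closed walk by one step keeps its length. This supplies the growth hypothesis
  of \<open>Image_relpow_eq_UNIV\<close> for \<open>R\<inverse>\<close>.\<close>

lemma closed_walk_successor:
  assumes "1 \<le> s"
  shows "{c. (c, c) \<in> R ^^ s} \<subseteq> R\<inverse> `` {c. (c, c) \<in> R ^^ s}"
proof
  fix c assume c: "c \<in> {c. (c, c) \<in> R ^^ s}"
  obtain t where t: "s = Suc t" using assms by (cases s) auto
  then have "(c, c) \<in> R ^^ Suc t" using c by simp
  then obtain d where "(c, d) \<in> R" "(d, c) \<in> R ^^ t" by (rule relpow_Suc_E2)
  then show "c \<in> R\<inverse> `` {c. (c, c) \<in> R ^^ s}" unfolding t by auto
qed

theorem wielandt_relpow:
  fixes R :: "'a::finite rel"
  assumes N: "R ^^ N = UNIV" "1 \<le> N"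
  shows "R ^^ ((CARD('a) - 1)\<^sup>2 + 1) = UNIV"
proof -
  have "\<exists>b. (a, b) \<in> R" for a
  proof -
    have "(a, a) \<in> R ^^ Suc (N - 1)" using N by simp
    then show ?thesis by (meson relpow_Suc_D2)
  qed
  then have dom: "Domain R = UNIV" by auto
  show ?thesis
  proof (cases "2 \<le> CARD('a)")
    case False
    then have "CARD('a) \<le> Suc 0" by simp
    then have "a = b" for a b :: 'a by (subst (asm) card_le_Suc0_iff_eq) auto
    \<comment> \<open>With a single vertex, the identity relation is already full.\<close>
    then have "R ^^ 0 = UNIV" by auto
    then show ?thesis using dom by (rule relpow_UNIV_mono) simp
  next
    case True
    define P where "P l \<longleftrightarrow> 1 \<le> l \<and> (\<exists>c. (c, c) \<in> R ^^ l)" for l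
    define s where "s = (LEAST l. P l)"
    define n where "n = CARD('a)"
    define C where "C = {c. (c, c) \<in> R ^^ s}"
    obtain s' where s': "P s'" "s' \<le> n - 1"
      using short_closed_walk[OF N(1) True] unfolding P_def n_def by blast
    have Ps: "P s" unfolding s_def using s'(1) by (rule LeastI)
    have s_le: "s \<le> n - 1" using Least_le[of P, OF s'(1)] s'(2) unfolding s_def by simp
    have s1: "1 \<le> s" using Ps by (simp add: P_def)
    obtain u where "(u, u) \<in> R ^^ s" using Ps by (auto simp: P_def)
    moreover have "(c, c) \<notin> R ^^ l" if "1 \<le> l" "l < s" for l c
      using not_less_Least[of l P] that unfolding s_def P_def by blast
    ultimately have cardC: "s \<le> card C" unfolding C_def by (rule card_closed_walk_ge)
    then have "C \<noteq> {}" using s1 by auto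
    have toC: "((R\<inverse>) ^^ (n - s)) `` C = UNIV"
    proof (rule Image_relpow_eq_UNIV)
      show "C \<subseteq> R\<inverse> `` C" unfolding C_def using s1 by (rule closed_walk_successor)
      show "((R\<inverse>) ^^ N) `` C = UNIV" using \<open>C \<noteq> {}\<close> by (auto simp: relpow_converse N(1))
      show "CARD('a) \<le> card C + (n - s)" using cardC s_le by (simp add: n_def)
    qed
    have fromC: "((R ^^ s) ^^ (n - 1)) `` {c} = UNIV" if "c \<in> C" for c
    proof (rule Image_relpow_eq_UNIV)
      show "{c} \<subseteq> (R ^^ s) `` {c}" using that by (simp add: C_def)
      \<comment> \<open>Fullness persists from \<open>N\<close> to \<open>s * N \<ge> N\<close>, so
        \<open>R ^^ s\<close> also has a full power.\<close>
      have "R ^^ (s * N) = UNIV" using s1 by (intro relpow_UNIV_mono[OF N(1) dom]) simp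
      then show "((R ^^ s) ^^ N) `` {c} = UNIV" by (auto simp: relpow_mult)
    qed (simp add: n_def)
    have "(a, b) \<in> R ^^ ((n - s) + s * (n - 1))" for a b
    proof -
      have "a \<in> ((R\<inverse>) ^^ (n - s)) `` C" by (simp add: toC)
      then obtain c where c: "c \<in> C" "(a, c) \<in> R ^^ (n - s)" by (auto simp: relpow_converse)
      have "(c, b) \<in> (R ^^ s) ^^ (n - 1)" using fromC[OF c(1)] by blast
      then show ?thesis using c(2) unfolding relpow_add relpow_mult by blast
    qed
    then have "R ^^ ((n - s) + s * (n - 1)) = UNIV" by auto
    moreover have "(n - s) + s * (n - 1) \<le> (n - 1)\<^sup>2 + 1"
    proof -
      have "n = s + (n - 1 - s) + 1" using s_le True by (simp add: n_def)
      then obtain d where d: "n = s + d + 1" ..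
      \<comment> \<open>With \<open>n - 1 = s + d\<close>, cancelling \<open>s * (s + d) + 1\<close>
        from the claim leaves exactly this.\<close>
      have "d \<le> d * (s + d)" using s1 by simp
      then show ?thesis unfolding d by (simp add: power2_eq_square algebra_simps)
    qed
    ultimately show ?thesis unfolding n_def by (rule relpow_UNIV_mono[OF _ dom])
  qed
qed

section \<open>Positivity patterns\<close>

definition pos_entries :: "real ^ 'n ^ 'n \<Rightarrow> 'n::finite rel" where
  "pos_entries M = {(i, j). 0 < M $ i $ j}"

text \<open>A sum of nonnegative terms is positive iff some term is. Nonnegativity is carried
  through the same induction because this step relies on it.\<close>

lemma matrix_power_pos_entries:
  assumes nonneg: "\<And>i j. 0 \<le> M $ i $ j"
  shows "0 \<le> matrix_power M r $ i $ j \<and>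
    (0 < matrix_power M r $ i $ j \<longleftrightarrow> (i, j) \<in> pos_entries M ^^ r)"
proof (induction r arbitrary: i)
  case 0
  show ?case by (simp add: matrix_power_def mat_def)
next
  case (Suc r)
  let ?P = "matrix_power M r"
  have eq: "matrix_power M (Suc r) $ i $ j = (\<Sum>k\<in>UNIV. M $ i $ k * ?P $ k $ j)"
    by (simp add: matrix_power_def matrix_matrix_mult_def)
  have ge: "0 \<le> M $ i $ k * ?P $ k $ j" for k using nonneg Suc by simp
  have nonneg_Suc: "0 \<le> matrix_power M (Suc r) $ i $ j"
    unfolding eq using ge by (simp add: sum_nonneg)
  have "matrix_power M (Suc r) $ i $ j = 0 \<longleftrightarrow> (\<forall>k. M $ i $ k * ?P $ k $ j = 0)"
    unfolding eq using ge by (subst sum_nonneg_eq_0_iff) auto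
  then have "0 < matrix_power M (Suc r) $ i $ j \<longleftrightarrow> (\<exists>k. 0 < M $ i $ k * ?P $ k $ j)"
    using ge nonneg_Suc by (metis order_less_le)
  also have "\<dots> \<longleftrightarrow> (\<exists>k. (i, k) \<in> pos_entries M \<and> (k, j) \<in> pos_entries M ^^ r)"
    using nonneg Suc by (simp add: pos_entries_def zero_less_mult_iff not_less[symmetric])
  also have "\<dots> \<longleftrightarrow> (i, j) \<in> pos_entries M ^^ Suc r"
    \<comment> \<open>\<open>matrix_power\<close> multiplies on the left, whereas \<open>^^\<close>
      on relations composes on the right.\<close>
    unfolding relpow.simps(2) relpow_commute[symmetric] by blast
  finally show ?case using nonneg_Suc by simp
qed

lemma matrix_power_pos_iff:
  assumes "\<And>i j. 0 \<le> M $ i $ j"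
  shows "matrix_power_pos M r \<longleftrightarrow> pos_entries M ^^ r = UNIV"
  unfolding matrix_power_pos_def using matrix_power_pos_entries[OF assms] by auto

theorem wielandt_matrix:
  fixes M :: "real ^ 'n ^ 'n::finite"
  assumes nonneg: "\<And>i j. 0 \<le> M $ i $ j" and "matrix_primitive M"
  shows "matrix_primitive_degree M \<le> (CARD('n) - 1)\<^sup>2 + 1"
proof -
  obtain N where "1 \<le> N" "pos_entries M ^^ N = UNIV"
    using assms(2) by (auto simp: matrix_primitive_def matrix_power_pos_iff[OF nonneg])
  then have "matrix_power_pos M ((CARD('n) - 1)\<^sup>2 + 1)"
    unfolding matrix_power_pos_iff[OF nonneg] by (intro wielandt_relpow)
  then show ?thesis unfolding matrix_primitive_degree_def by (intro Least_le) simp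
qed

section \<open>Propagation of positivity under the tensor map\<close>

lemma finite_lists_of_length: "finite {js :: 'n::finite list. length js = k}"
  using finite_lists_length_eq[of "UNIV :: 'n set" k] by simp

context
  fixes A :: "'n::finite tensor" and m :: nat
  assumes m: "m \<ge> 2" and nonneg: "nonneg_tensor m A"
begin

lemma tensor_term_nonneg:
  assumes "\<And>i. 0 \<le> x $ i" "length js = m - 1"
  shows "0 \<le> A (i # js) * (\<Prod>j\<leftarrow>js. x $ j)"
proof -
  have "0 \<le> A (i # js)" using nonneg m assms(2) by (simp add: nonneg_tensor_def)
  moreover have "0 \<le> (\<Prod>j\<leftarrow>js. x $ j)" using assms(1) by (induction js) auto
  ultimately show ?thesis by simp
qed

lemma tensor_map_nonneg:
  assumes "\<And>i. 0 \<le> x $ i"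
  shows "0 \<le> tensor_map m A x $ i"
  unfolding tensor_map_def tensor_apply_def
  using m assms by (auto intro!: sum_nonneg tensor_term_nonneg)

lemma tensor_map_pos_step:
  assumes "\<And>i. 0 \<le> x $ i" "(i, j) \<in> pos_entries (majorization_matrix m A)" "0 < x $ j"
  shows "0 < tensor_map m A x $ i"
proof -
  have "0 < A (i # replicate (m - 1) j) * (\<Prod>k\<leftarrow>replicate (m - 1) j. x $ k)"
    using assms(2,3) by (simp add: pos_entries_def majorization_matrix_def)
  then have "0 < tensor_apply m A x $ i"
    unfolding tensor_apply_def vec_lambda_beta
    by (intro sum_pos2[of _ "replicate (m - 1) j"] finite_lists_of_length)
       (auto intro: tensor_term_nonneg assms(1))
  \<comment> \<open>\<open>m \<ge> 2\<close> matters: \<open>root 0\<close> is constantly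
    zero.\<close>
  then show ?thesis using m by (simp add: tensor_map_def)
qed

lemma tensor_map_iterate_nonneg:
  assumes "\<And>i. 0 \<le> x $ i"
  shows "0 \<le> (tensor_map m A ^^ r) x $ i"
  by (induction r arbitrary: i) (auto intro: assms tensor_map_nonneg)

lemma tensor_map_iterate_pos:
  assumes "\<And>i. 0 \<le> x $ i" "(i, j) \<in> pos_entries (majorization_matrix m A) ^^ r" "0 < x $ j"
  shows "0 < (tensor_map m A ^^ r) x $ i"
  using assms(2)
proof (induction r arbitrary: i)
  case 0
  then show ?case using assms(3) by simp
next
  case (Suc r)
  then obtain k where "(i, k) \<in> pos_entries (majorization_matrix m A)"
    "(k, j) \<in> pos_entries (majorization_matrix m A) ^^ r" by (meson relpow_Suc_D2)
  then show ?case
    using Suc.IH by (auto intro!: tensor_map_pos_step tensor_map_iterate_nonneg assms(1))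
qed

lemma majorization_matrix_nonneg: "0 \<le> majorization_matrix m A $ i $ j"
  using nonneg m by (simp add: majorization_matrix_def nonneg_tensor_def)

text \<open>A nonzero nonnegative \<open>x\<close> is positive at some \<open>j\<close>, and every
  \<open>i\<close> has a walk of length \<open>r\<close> to that \<open>j\<close>.\<close>

lemma tensor_map_pos_if_matrix_power_pos:
  assumes "matrix_power_pos (majorization_matrix m A) r"
  shows "tensor_map_pos m A r"
  unfolding tensor_map_pos_def
proof (intro allI impI)
  fix x :: "real ^ 'n" and i
  assume x: "(\<forall>i. 0 \<le> x $ i) \<and> x \<noteq> 0"
  then obtain j where "x $ j \<noteq> 0" by (auto simp: vec_eq_iff)
  then have "0 < x $ j" using x by (simp add: less_le)
  then show "0 < (tensor_map m A ^^ r) x $ i"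
    using x assms by (intro tensor_map_iterate_pos[of x i j])
      (auto simp: matrix_power_pos_iff[OF majorization_matrix_nonneg])
qed

end

theorem corollary4p1:
  fixes A :: "'n::finite tensor" and m :: nat
  assumes "m \<ge> 2"
    and "nonneg_tensor m A"
    and "matrix_primitive (majorization_matrix m A)"
  shows "tensor_primitive m A
    \<and> tensor_primitive_degree m A \<le> matrix_primitive_degree (majorization_matrix m A)
    \<and> matrix_primitive_degree (majorization_matrix m A) \<le> (CARD('n) - 1)\<^sup>2 + 1"
proof -
  let ?M = "majorization_matrix m A"
  let ?r = "matrix_primitive_degree ?M"
  have "1 \<le> ?r \<and> matrix_power_pos ?M ?r"
    using assms(3) unfolding matrix_primitive_def matrix_primitive_degree_def
    by (elim exE) (rule LeastI)
  then have r: "1 \<le> ?r" "tensor_map_pos m A ?r"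
    using tensor_map_pos_if_matrix_power_pos[OF assms(1,2)] by auto
  then have "tensor_primitive m A" by (auto simp: tensor_primitive_def)
  moreover have "tensor_primitive_degree m A \<le> ?r"
    unfolding tensor_primitive_degree_def using r by (intro Least_le) simp
  moreover have "?r \<le> (CARD('n) - 1)\<^sup>2 + 1"
    using majorization_matrix_nonneg[OF assms(1,2)] assms(3) by (rule wielandt_matrix)
  ultimately show ?thesis by blast
qed

end
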